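(* For every integer $k\ge 0$, the Hirzebruch number $\mathfrak h_k=\prod_{p\ \mathrm{prime}}p^{\lfloor k/(p-1)\rfloor}$ satisfies $$\mathfrak h_k=\operatorname{lcm}\bigl\{(\lambda_1+1)!\cdots(\lambda_l+1)!\ :\ \lambda=(\lambda_1,\dots,\lambda_l)\in\mathcal P_k\bigr\}$$ and, equivalently, $$\mathfrak h_k=\operatorname{lcm}\bigl\{(\lambda_1+1)\cdots(\lambda_l+1)\ :\ \lambda=(\lambda_1,\dots,\lambda_l)\in\mathcal P_k\bigr\}.$$
   Context: $\lfloor x\rfloor$ is the largest integer not exceeding $x$. $\mathcal P_k$ is the set of all partitions $\lambda=(\lambda_1,\dots,\lambda_l)$ of $k$, i.e. weakly decreasing finite sequences of positive integers with $|\lambda|:=\lambda_1+\dots+\lambda_l=k$ (for $k=0$ only the empty partition, whose associated product is $1$). The product over primes is finite, since the exponent vanishes for $p>k+1$. *)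

theory Defs
  imports Complex_Main "HOL-Computational_Algebra.Primes" "HOL-Library.Groups_Big_Fun"
begin

text \<open>For \<open>k = 0\<close> the only element is the empty list.\<close>

definition partitions :: "nat \<Rightarrow> nat list set" where
  "partitions k = {xs. sorted_wrt (\<ge>) xs \<and> (\<forall>x \<in> set xs. 0 < x) \<and> sum_list xs = k}"

text \<open>
  Here \<open>\<Prod>p\<close> is the product over all natural numbers of a family that differs from \<open>1\<close>
  only finitely often (it would be \<open>1\<close> by convention for a family with infinitely many
  factors different from \<open>1\<close>); \<open>div\<close> on natural numbers is the floor of the quotient,
  and \<open>p - 1\<close> does not truncate as \<open>p\<close> is prime.
\<close>

definition hirzebruch :: "nat \<Rightarrow> nat" where
  "hirzebruch k = (\<Prod>p. if prime p then p ^ (k div (p - 1)) else 1)"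

lemma hirzebruch_exponent_floor:
  assumes "prime (p :: nat)"
  shows "int (k div (p - 1)) = \<lfloor>real k / (real p - 1)\<rfloor>"
proof -
  have "real p - 1 = real (p - 1)"
    using prime_ge_1_nat[OF assms] by (simp add: of_nat_diff)
  then show ?thesis
    by (simp only: floor_divide_of_nat_eq)
qed

lemma hirzebruch_support:
  "{p. (if prime p then p ^ (k div (p - 1)) else 1) \<noteq> (1 :: nat)} \<subseteq> {p. prime p \<and> p \<le> k + 1}"
  by (auto split: if_splits intro: ccontr)

lemma hirzebruch_eq_prod:
  "hirzebruch k = (\<Prod>p | prime p \<and> p \<le> k + 1. p ^ (k div (p - 1)))"
proof -
  have "finite {p :: nat. prime p \<and> p \<le> k + 1}"
    by (rule finite_subset[of _ "{..k + 1}"]) auto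
  then show ?thesis
    unfolding hirzebruch_def
    by (subst Prod_any.expand_superset[OF _ hirzebruch_support]) (auto intro: prod.cong)
qed

text \<open>\<open>Lcm\<close> of an infinite set of natural numbers is \<open>0\<close>, so finiteness matters.\<close>

lemma finite_partitions: "finite (partitions k)"
proof (rule finite_subset)
  have "length xs \<le> sum_list xs" if "\<forall>x \<in> set xs. 0 < x" for xs :: "nat list"
    using that by (induction xs) auto
  then show "partitions k \<subseteq> {xs. set xs \<subseteq> {..k} \<and> length xs \<le> k}"
    by (auto simp: partitions_def member_le_sum_list)
qed (simp add: finite_lists_length_le)

end

theory Submission
  imports Defs
begin

text \<open>
  Both identities are read off prime by prime: the multiplicity of a prime \<open>p\<close> in
  \<open>hirzebruch k\<close> is \<open>k div (p - 1)\<close>.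

  For the upper bound, Legendre's formula shows that \<open>p\<close> occurs at most \<open>x div (p - 1)\<close> times in
  \<open>(x + 1)!\<close>.  Multiplied by \<open>p - 1\<close> this bound is linear in \<open>x\<close>, so it adds up over the parts of
  a partition of \<open>k\<close>, and every product \<open>\<Prod>(\<lambda>\<^sub>i + 1)!\<close> divides \<open>hirzebruch k\<close>
  (\<open>prod_fact_partition_dvd_hirzebruch\<close>).

  For the lower bound, the exponent \<open>k div (p - 1)\<close> is attained, already without factorials, by
  the partition with \<open>k div (p - 1)\<close> parts equal to \<open>p - 1\<close> and the remainder filled up with ones
  (\<open>ex_partition_prime_power_dvd\<close>).

  Since \<open>\<Prod>(\<lambda>\<^sub>i + 1)\<close> divides \<open>\<Prod>(\<lambda>\<^sub>i + 1)!\<close>, these two bounds squeeze both least common multiples.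
\<close>

text \<open>
  One step of Legendre's formula: the multiples of \<open>p\<close> up to \<open>n\<close> are \<open>p, 2p, \<dots>, (n div p) p\<close>, and
  their product is \<open>p ^ (n div p) * (n div p)!\<close>; the other factors of \<open>n!\<close> are prime to \<open>p\<close>.
\<close>

lemma multiplicity_fact_div:
  fixes p n :: nat
  assumes p: "prime p"
  shows "multiplicity p (fact n :: nat) = n div p + multiplicity p (fact (n div p) :: nat)"
proof (induction n)
  case (Suc n)
  have split: "multiplicity p (fact (Suc n) :: nat)
      = multiplicity p (Suc n) + multiplicity p (fact n :: nat)"
    using p by (simp add: prime_elem_multiplicity_mult_distrib del: mult_Suc)
  show ?case
  proof (cases "p dvd Suc n")
    case True
    then obtain m where m: "Suc n = p * Suc m"
      by (metis dvd_def mult_0_right nat.distinct(1) not0_implies_Suc)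
    have div_Suc_n: "Suc n div p = Suc m"
      unfolding m using prime_gt_0_nat[OF p] by (simp del: mult_Suc_right)
    with True have div_n: "n div p = m"
      by (simp add: div_Suc mod_eq_0_iff_dvd)
    have "multiplicity p (Suc n) = Suc (multiplicity p (Suc m))"
      unfolding m using p by (subst multiplicity_times_same) auto
    moreover have "multiplicity p (fact (Suc m) :: nat)
        = multiplicity p (Suc m) + multiplicity p (fact m :: nat)"
      using p by (simp add: prime_elem_multiplicity_mult_distrib del: mult_Suc)
    ultimately show ?thesis
      using split Suc div_Suc_n div_n by simp
  next
    case False
    then show ?thesis
      using split Suc by (simp add: div_Suc mod_eq_0_iff_dvd not_dvd_imp_multiplicity_0 del: fact_Suc)
  qed
qed simp

text \<open>
  Legendre's formula gives \<open>(p - 1) v\<^sub>p(n!) = n - s\<close> with \<open>s\<close> the sum of the base-\<open>p\<close> digits of \<open>n\<close>, and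
  \<open>s \<ge> 1\<close> for \<open>n > 0\<close>.  The induction over \<open>n div p\<close> strips off one digit at a time.
\<close>

lemma multiplicity_fact_bound:
  fixes p n :: nat
  assumes p: "prime p" and "n > 0"
  shows "multiplicity p (fact n :: nat) * (p - 1) < n"
  using \<open>n > 0\<close>
proof (induction n rule: less_induct)
  case (less n)
  define q where "q = n div p"
  have v: "multiplicity p (fact n :: nat) = q + multiplicity p (fact q :: nat)"
    unfolding q_def by (rule multiplicity_fact_div[OF p])
  show ?case
  proof (cases "q = 0")
    case False
    have "q < n"
      unfolding q_def using prime_gt_1_nat[OF p] less.prems by (intro div_less_dividend) auto
    with less.IH False have "multiplicity p (fact q :: nat) * (p - 1) < q"
      by simp
    then have "multiplicity p (fact n :: nat) * (p - 1) < q * (p - 1) + q"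
      by (simp add: v add_mult_distrib)
    also have "\<dots> = q * p"
      using prime_gt_0_nat[OF p] by (cases p) simp_all
    also have "\<dots> \<le> n"
      by (simp add: q_def)
    finally show ?thesis .
  qed (use less.prems v in simp)
qed

lemma multiplicity_prod_fact_bound:
  fixes p :: nat
  assumes p: "prime p"
  shows "multiplicity p (\<Prod>x\<leftarrow>xs. fact (x + 1) :: nat) * (p - 1) \<le> sum_list xs"
proof (induction xs)
  case (Cons x xs)
  have nz: "(\<Prod>x\<leftarrow>xs. fact (x + 1) :: nat) \<noteq> 0"
    by (auto simp: prod_list_zero_iff image_iff simp del: fact_Suc)
  have "multiplicity p (\<Prod>x\<leftarrow>x # xs. fact (x + 1) :: nat)
      = multiplicity p (fact (x + 1) :: nat) + multiplicity p (\<Prod>x\<leftarrow>xs. fact (x + 1) :: nat)"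
    using p nz by (simp add: prime_elem_multiplicity_mult_distrib del: fact_Suc)
  moreover have "multiplicity p (fact (x + 1) :: nat) * (p - 1) \<le> x"
    using multiplicity_fact_bound[OF p, of "x + 1"] by simp
  ultimately show ?case
    using Cons.IH by (simp add: add_mult_distrib)
qed simp

lemma multiplicity_hirzebruch:
  assumes p: "prime p"
  shows "multiplicity p (hirzebruch k) = k div (p - 1)"
proof -
  have "finite {q :: nat. prime q \<and> q \<le> k + 1}"
    by (rule finite_subset[of _ "{..k + 1}"]) auto
  then have "multiplicity p (hirzebruch k) = (if p \<le> k + 1 then k div (p - 1) else 0)"
    unfolding hirzebruch_eq_prod using p by (subst multiplicity_prod_prime_powers) auto
  then show ?thesis
    by simp
qed

lemma hirzebruch_nonzero: "hirzebruch k \<noteq> 0"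
  by (auto simp: hirzebruch_eq_prod)

lemma prod_fact_partition_dvd_hirzebruch:
  assumes "xs \<in> partitions k"
  shows "(\<Prod>x\<leftarrow>xs. fact (x + 1)) dvd hirzebruch k"
proof (rule multiplicity_le_imp_dvd)
  show "(\<Prod>x\<leftarrow>xs. fact (x + 1) :: nat) \<noteq> 0"
    by (auto simp: prod_list_zero_iff image_iff simp del: fact_Suc)
next
  fix p :: nat
  assume p: "prime p"
  have "p - 1 > 0"
    using prime_gt_1_nat[OF p] by simp
  moreover have "multiplicity p (\<Prod>x\<leftarrow>xs. fact (x + 1) :: nat) * (p - 1) \<le> k"
    using multiplicity_prod_fact_bound[OF p, of xs] assms by (simp add: partitions_def)
  ultimately show "multiplicity p (\<Prod>x\<leftarrow>xs. fact (x + 1)) \<le> multiplicity p (hirzebruch k)"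
    by (simp add: multiplicity_hirzebruch[OF p] less_eq_div_iff_mult_less_eq)
qed

lemma sorted_wrt_replicate_ge: "sorted_wrt (\<ge>) (replicate n (x :: nat))"
  by (induction n) auto

lemma ex_partition_prime_power_dvd:
  assumes p: "prime (p :: nat)"
  shows "\<exists>xs\<in>partitions k. p ^ (k div (p - 1)) dvd (\<Prod>x\<leftarrow>xs. (x + 1))"
proof
  define xs where "xs = replicate (k div (p - 1)) (p - 1) @ replicate (k mod (p - 1)) 1"
  have "p > 1"
    by (rule prime_gt_1_nat[OF p])
  then show "xs \<in> partitions k"
    by (auto simp: partitions_def xs_def sorted_wrt_append sum_list_replicate div_mult_mod_eq
        intro: sorted_wrt_replicate_ge)
  show "p ^ (k div (p - 1)) dvd (\<Prod>x\<leftarrow>xs. (x + 1))"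
    using \<open>p > 1\<close> by (simp add: xs_def prod_list_replicate)
qed

text \<open>
  The two families of the theorem differ only in the factor attached to a part; all that matters
  is that it lies between \<open>x + 1\<close> and \<open>(x + 1)!\<close> in the divisibility order.
\<close>

lemma hirzebruch_eq_Lcm:
  fixes f :: "nat \<Rightarrow> nat"
  assumes lower: "\<And>x. x + 1 dvd f x" and upper: "\<And>x. f x dvd fact (x + 1)"
  shows "hirzebruch k = Lcm {\<Prod>x\<leftarrow>xs. f x | xs. xs \<in> partitions k}"
proof -
  have prod_mono: "(\<Prod>x\<leftarrow>xs. g x) dvd (\<Prod>x\<leftarrow>xs. h x)" if "\<And>x. g x dvd h x"
    for g h :: "nat \<Rightarrow> nat" and xs
    by (induction xs) (auto intro!: mult_dvd_mono that)
  let ?L = "Lcm {\<Prod>x\<leftarrow>xs. f x | xs. xs \<in> partitions k}"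
  have L_dvd: "?L dvd hirzebruch k"
    by (rule Lcm_least)
       (auto intro: dvd_trans[OF prod_mono[OF upper] prod_fact_partition_dvd_hirzebruch])
  have "hirzebruch k dvd ?L"
  proof (rule multiplicity_le_imp_dvd)
    show "hirzebruch k \<noteq> 0"
      by (rule hirzebruch_nonzero)
  next
    fix p :: nat
    assume p: "prime p"
    obtain xs where xs: "xs \<in> partitions k" "p ^ (k div (p - 1)) dvd (\<Prod>x\<leftarrow>xs. (x + 1))"
      using ex_partition_prime_power_dvd[OF p] by blast
    note xs(2)
    also have "(\<Prod>x\<leftarrow>xs. (x + 1)) dvd (\<Prod>x\<leftarrow>xs. f x)"
      by (rule prod_mono[OF lower])
    also have "(\<Prod>x\<leftarrow>xs. f x) dvd ?L"
      using xs(1) by (intro dvd_Lcm) blast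
    finally have dvd: "p ^ (k div (p - 1)) dvd ?L" .
    have "?L \<noteq> 0"
      using L_dvd hirzebruch_nonzero[of k] by (metis dvd_0_left_iff)
    then show "multiplicity p (hirzebruch k) \<le> multiplicity p ?L"
      using p dvd by (auto simp: multiplicity_hirzebruch intro!: multiplicity_geI)
  qed
  then show ?thesis
    using L_dvd by (rule dvd_antisym)
qed

theorem theorem1p1:
  fixes k :: nat
  shows "hirzebruch k = Lcm {\<Prod>x\<leftarrow>xs. fact (x + 1) | xs. xs \<in> partitions k}
    \<and> hirzebruch k = Lcm {\<Prod>x\<leftarrow>xs. (x + 1) | xs. xs \<in> partitions k}"
proof
  have dvd: "x + 1 dvd (fact (x + 1) :: nat)" for x :: nat
    by (simp add: dvd_fact del: fact_Suc)
  show "hirzebruch k = Lcm {\<Prod>x\<leftarrow>xs. fact (x + 1) | xs. xs \<in> partitions k}"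
    by (rule hirzebruch_eq_Lcm[OF dvd dvd_refl])
  show "hirzebruch k = Lcm {\<Prod>x\<leftarrow>xs. (x + 1) | xs. xs \<in> partitions k}"
    by (rule hirzebruch_eq_Lcm[OF dvd_refl dvd])
qed

end
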